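(* Assume that the following statement (a conjecture of Blekherman) is true: a form $p \in P_{3,6}$ belongs to $\Sigma_{3,6}$ if and only if for every $\mathbf{v}_1, \dots, \mathbf{v}_9 \in \mathbb{R}^3$ and every $\alpha_2, \dots, \alpha_9 \in \{-1,1\}$ such that $\mathbf{v}_1^{3} = \sum_{i=2}^9 \alpha_i \mathbf{v}_i^{3}$, one has $$p(\mathbf{v}_1) \le \left(\sum_{i=2}^9 \sqrt{p(\mathbf{v}_i)}\right)^2.$$ Then every convex ternary sextic form is a sum of squares; that is, $C_{3,6} \subseteq \Sigma_{3,6}$.
   Context: $H_{n,k}$ denotes the vector space of homogeneous real polynomials (forms) in $n$ variables of degree $k$. A ternary sextic is an element of $H_{3,6}$. $P_{n,2d} = \{p \in H_{n,2d} : p(\mathbf{x}) \ge 0 \ \forall \mathbf{x} \in \mathbb{R}^n\}$ is the cone of nonnegative forms. $C_{n,2d} = \{p \in H_{n,2d} : \nabla^2 p(\mathbf{x}) \succeq 0 \ \forall \mathbf{x} \in \mathbb{R}^n\}$ is the cone of convex forms, where $\nabla^2 p$ is the Hessian and $\succeq 0$ means positive semidefinite. $\Sigma_{n,2d} = \{p \in H_{n,2d} : p = \sum_i q_i^2 \text{ for some finitely many forms } q_i \in H_{n,d}\}$ is the cone of sum of squares (sos) forms. For a vector $\mathbf{v}$, $\mathbf{v}^{3} = \mathbf{v}\otimes\mathbf{v}\otimes\mathbf{v}$ denotes the (symmetric) outer product of $\mathbf{v}$ with itself $3$ times. *)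

theory Defs
  imports "HOL-Analysis.Analysis"
begin

text \<open>
  A form in \<open>CARD('n)\<close> variables is represented by the function it induces on \<open>real ^ 'n\<close>;
  over the reals, a polynomial is determined by its function. The sum below ranges over the
  (finitely many) exponent vectors of total degree \<open>k\<close>.
\<close>

definition forms :: "nat \<Rightarrow> (real ^ 'n::finite \<Rightarrow> real) set" where
  "forms k = {p. \<exists>c :: ('n \<Rightarrow> nat) \<Rightarrow> real.
     p = (\<lambda>x. \<Sum>a | (\<Sum>i\<in>UNIV. a i) = k. c a * (\<Prod>i\<in>UNIV. (x $ i) ^ a i))}"

definition partial_deriv :: "'n::finite \<Rightarrow> (real ^ 'n \<Rightarrow> real) \<Rightarrow> real ^ 'n \<Rightarrow> real" where
  "partial_deriv i f x = deriv (\<lambda>t. f (x + t *\<^sub>R axis i 1)) 0"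

definition hessian :: "(real ^ 'n::finite \<Rightarrow> real) \<Rightarrow> real ^ 'n \<Rightarrow> real ^ 'n ^ 'n" where
  "hessian f x = (\<chi> i j. partial_deriv i (partial_deriv j f) x)"

definition pos_semidef :: "real ^ 'n::finite ^ 'n \<Rightarrow> bool" where
  "pos_semidef A \<longleftrightarrow> transpose A = A \<and> (\<forall>u. 0 \<le> u \<bullet> (A *v u))"

text \<open>In the following three cones the argument \<open>d\<close> is half the degree.\<close>

definition psd_forms :: "nat \<Rightarrow> (real ^ 'n::finite \<Rightarrow> real) set" where
  "psd_forms d = {p \<in> forms (2 * d). \<forall>x. 0 \<le> p x}"

definition convex_forms :: "nat \<Rightarrow> (real ^ 'n::finite \<Rightarrow> real) set" where
  "convex_forms d = {p \<in> forms (2 * d). \<forall>x. pos_semidef (hessian p x)}"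

definition sos_forms :: "nat \<Rightarrow> (real ^ 'n::finite \<Rightarrow> real) set" where
  "sos_forms d = {p \<in> forms (2 * d).
     \<exists>qs. set qs \<subseteq> forms d \<and> p = (\<lambda>x. \<Sum>q\<leftarrow>qs. (q x)\<^sup>2)}"

definition outer_cube :: "real ^ 'n::finite \<Rightarrow> real ^ 'n ^ 'n ^ 'n" where
  "outer_cube v = (\<chi> i j k. v $ i * v $ j * v $ k)"

end

theory Submission imports Defs begin

text \<open>
  Let \<open>p\<close> be a convex form of degree \<open>2d\<close> and \<open>p x > 0\<close>. By Euler's identity, the normalised
  differential \<open>L = Dp(x) / (2d p(x))\<close> satisfies \<open>L x = 1\<close>, and the tangent inequality at \<open>x\<close> reads
  \<open>2d p(x) L(y) \<le> p(y) + (2d - 1) p(x)\<close>. Replacing \<open>y\<close> by \<open>y / L(y)\<close> gives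
  \<open>L(y)^(2d) p(x) \<le> p(y)\<close>: \<open>L\<close> is a norming functional at \<open>x\<close> for the seminorm \<open>p^(1/2d)\<close>.
  For \<open>d = 3\<close>, applying \<open>L \<otimes> L \<otimes> L\<close> to the tensor identity gives
  \<open>1 = \<Sum>\<^sub>i \<alpha>\<^sub>i L(v\<^sub>i)^3 \<le> \<Sum>\<^sub>i \<bar>L(v\<^sub>i)\<bar>^3\<close>, and \<open>\<bar>L(v\<^sub>i)\<bar>^3 sqrt(p(v\<^sub>1)) \<le> sqrt(p(v\<^sub>i))\<close>.
\<close>

section \<open>Derivatives of polynomial functions\<close>

lemma real_polynomial_function_derivs_exist:
  fixes f :: "real ^ 'n::finite \<Rightarrow> real"
  assumes "real_polynomial_function f"
  shows "\<exists>D. (\<forall>i. real_polynomial_function (D i)) \<and>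
    (\<forall>x. (f has_derivative (\<lambda>h. \<Sum>i\<in>UNIV. h $ i * D i x)) (at x))"
  using assms
proof (induction rule: real_polynomial_function.induct)
  case (linear f)
  have "(\<Sum>i\<in>UNIV. h $ i * f (axis i 1)) = f h" for h
  proof -
    have "f h = f (\<Sum>i\<in>UNIV. h $ i *\<^sub>R axis i 1)"
      using basis_expansion[of h] by (simp add: scalar_mult_eq_scaleR)
    also have "\<dots> = (\<Sum>i\<in>UNIV. h $ i * f (axis i 1))"
      using linear[THEN bounded_linear.linear] by (simp add: linear_sum linear_scale)
    finally show ?thesis by simp
  qed
  then show ?case
    using linear
    by (intro exI[of _ "\<lambda>i x. f (axis i 1)"])
      (auto intro: bounded_linear_imp_has_derivative)
next
  case (const c)
  show ?case
    by (intro exI[of _ "\<lambda>i x. 0"]) auto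
next
  case (add f g)
  then obtain D E where "\<forall>i. real_polynomial_function (D i)" "\<forall>i. real_polynomial_function (E i)"
    and D: "\<And>x. (f has_derivative (\<lambda>h. \<Sum>i\<in>UNIV. h $ i * D i x)) (at x)"
    and E: "\<And>x. (g has_derivative (\<lambda>h. \<Sum>i\<in>UNIV. h $ i * E i x)) (at x)"
    by blast
  moreover have "((\<lambda>x. f x + g x) has_derivative (\<lambda>h. \<Sum>i\<in>UNIV. h $ i * (D i x + E i x))) (at x)" for x
    using has_derivative_add[OF D E] by (simp add: sum.distrib algebra_simps)
  ultimately show ?case
    by (intro exI[of _ "\<lambda>i x. D i x + E i x"]) auto
next
  case (mult f g)
  then obtain D E where "\<forall>i. real_polynomial_function (D i)" "\<forall>i. real_polynomial_function (E i)"
    and D: "\<And>x. (f has_derivative (\<lambda>h. \<Sum>i\<in>UNIV. h $ i * D i x)) (at x)"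
    and E: "\<And>x. (g has_derivative (\<lambda>h. \<Sum>i\<in>UNIV. h $ i * E i x)) (at x)"
    by blast
  moreover have "((\<lambda>x. f x * g x) has_derivative
      (\<lambda>h. \<Sum>i\<in>UNIV. h $ i * (f x * E i x + D i x * g x))) (at x)" for x
    using has_derivative_mult[OF D E]
    by (simp add: sum.distrib sum_distrib_left sum_distrib_right algebra_simps)
  ultimately show ?case
    using mult(1,2)
    by (intro exI[of _ "\<lambda>i x. f x * E i x + D i x * g x"])
      (simp add: real_polynomial_function.intros(3,4))
qed

lemma partial_deriv_eq:
  assumes "(f has_derivative (\<lambda>h. \<Sum>j\<in>UNIV. h $ j * D j)) (at x)"
  shows "partial_deriv i f x = D i"
proof -
  have "((\<lambda>t::real. x + t *\<^sub>R axis i 1) has_derivative (\<lambda>t. t *\<^sub>R axis i 1)) (at 0)"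
    by (auto intro!: derivative_eq_intros)
  then have "((\<lambda>t. f (x + t *\<^sub>R axis i 1)) has_derivative
      (\<lambda>t. \<Sum>j\<in>UNIV. (t *\<^sub>R axis i 1) $ j * D j)) (at 0)"
    by (rule has_derivative_compose) (use assms in simp)
  moreover have "(\<Sum>j\<in>UNIV. (t *\<^sub>R axis i 1) $ j * D j) = D i * t" for t :: real
  proof -
    have "(\<Sum>j\<in>UNIV. (t *\<^sub>R axis i 1) $ j * D j) = (\<Sum>j\<in>UNIV. if j = i then D i * t else 0)"
      by (rule sum.cong) (auto simp: axis_def)
    then show ?thesis by simp
  qed
  ultimately show ?thesis
    unfolding partial_deriv_def by (intro DERIV_imp_deriv) (simp add: has_field_derivative_def)
qed

text \<open>\<open>deriv\<close> is total, so its value alone does not give differentiability. The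
  induction therefore produces explicit derivatives \<open>D\<close>, identified with
  \<open>partial_deriv\<close> only here. That they are again polynomial lets one differentiate
  twice, as the Hessian requires.\<close>

lemma
  fixes f :: "real ^ 'n::finite \<Rightarrow> real"
  assumes "real_polynomial_function f"
  shows real_polynomial_function_partial_deriv: "real_polynomial_function (partial_deriv i f)"
    and real_polynomial_function_has_derivative:
      "(f has_derivative (\<lambda>h. \<Sum>i\<in>UNIV. h $ i * partial_deriv i f x)) (at x)"
proof -
  obtain D where D: "\<forall>i. real_polynomial_function (D i)"
    "\<forall>x. (f has_derivative (\<lambda>h. \<Sum>i\<in>UNIV. h $ i * D i x)) (at x)"
    using real_polynomial_function_derivs_exist[OF assms] by blast
  have "partial_deriv i f = D i" for i
    using D(2) by (auto intro!: partial_deriv_eq)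
  with D show "real_polynomial_function (partial_deriv i f)"
    "(f has_derivative (\<lambda>h. \<Sum>i\<in>UNIV. h $ i * partial_deriv i f x)) (at x)"
    by auto
qed

lemma real_polynomial_function_has_directional_derivative:
  fixes f :: "real ^ 'n::finite \<Rightarrow> real"
  assumes "real_polynomial_function f"
  shows "((\<lambda>t. f (x + t *\<^sub>R u)) has_real_derivative
    (\<Sum>i\<in>UNIV. u $ i * partial_deriv i f (x + t *\<^sub>R u))) (at t)"
proof -
  have "((\<lambda>t::real. x + t *\<^sub>R u) has_derivative (\<lambda>s. s *\<^sub>R u)) (at t)"
    by (auto intro!: derivative_eq_intros)
  from has_derivative_compose[OF this real_polynomial_function_has_derivative[OF assms]]
  show ?thesis
    unfolding has_field_derivative_def
    by (rule has_derivative_eq_rhs) (simp add: fun_eq_iff sum_distrib_left mult_ac)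
qed

section \<open>Homogeneity and Euler's identity\<close>

lemma form_imp_real_polynomial_function:
  assumes "p \<in> forms k"
  shows "real_polynomial_function p"
proof -
  obtain c where p: "p = (\<lambda>x. \<Sum>a | (\<Sum>i\<in>UNIV. a i) = k. c a * (\<Prod>i\<in>UNIV. (x $ i) ^ a i))"
    using assms unfolding forms_def by blast
  have "real_polynomial_function (\<lambda>x. (x $ i) ^ m)" for i :: 'a and m
    by (rule real_polynomial_function_power)
      (rule real_polynomial_function.intros(1)[OF bounded_linear_vec_nth])
  then have "real_polynomial_function (\<lambda>x. c a * (\<Prod>i\<in>UNIV. (x $ i) ^ a i))" for a
    by (simp add: real_polynomial_function.intros(2,4) real_polynomial_function_prod)
  \<comment> \<open>The case split spares a finiteness proof for the set of exponents: over an
    infinite set the sum is 0 by convention, hence polynomial too.\<close>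
  then show ?thesis
    unfolding p
    by (cases "finite {a :: 'a \<Rightarrow> nat. sum a UNIV = k}")
      (simp_all add: real_polynomial_function_sum real_polynomial_function.intros(2))
qed

lemma form_scaleR:
  assumes "p \<in> forms k"
  shows "p (t *\<^sub>R x) = t ^ k * p x"
proof -
  obtain c where p: "p = (\<lambda>x. \<Sum>a | (\<Sum>i\<in>UNIV. a i) = k. c a * (\<Prod>i\<in>UNIV. (x $ i) ^ a i))"
    using assms unfolding forms_def by blast
  show ?thesis
    unfolding p sum_distrib_left
    by (rule sum.cong) (auto simp: power_mult_distrib prod.distrib simp flip: power_sum)
qed

lemma Euler_identity:
  assumes "p \<in> forms k"
  shows "(\<Sum>i\<in>UNIV. x $ i * partial_deriv i p x) = real k * p x"
proof -
  \<comment> \<open>Differentiate p along its own ray, x + tx = (1 + t)x, at t = 0 in two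
    ways.\<close>
  have "((\<lambda>t. (1 + t) ^ k * p x) has_real_derivative real k * p x) (at 0)"
    by (auto intro!: derivative_eq_intros)
  moreover have "(\<lambda>t. (1 + t) ^ k * p x) = (\<lambda>t. p (x + t *\<^sub>R x))"
    using form_scaleR[OF assms] by (metis scaleR_add_left scaleR_one)
  ultimately show ?thesis
    using real_polynomial_function_has_directional_derivative
      [OF form_imp_real_polynomial_function[OF assms], of x x 0]
    by (auto dest: DERIV_unique)
qed

section \<open>Convex forms and their norming functionals\<close>

lemma tangent_inequality:
  fixes f :: "real ^ 'n::finite \<Rightarrow> real"
  assumes f: "real_polynomial_function f" and hess: "\<And>z. pos_semidef (hessian f z)"
  shows "(\<Sum>i\<in>UNIV. u $ i * partial_deriv i f x) \<le> f (x + u) - f x"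
proof -
  \<comment> \<open>Restricted to a line, the second derivative is the quadratic form of the
    Hessian. So \<open>g\<close> is convex and lies above its tangent at 0, which is compared with
    \<open>g\<close> at 1.\<close>
  define g where "g t = f (x + t *\<^sub>R u)" for t
  define g' where "g' t = (\<Sum>i\<in>UNIV. u $ i * partial_deriv i f (x + t *\<^sub>R u))" for t
  define g'' where "g'' t = u \<bullet> (hessian f (x + t *\<^sub>R u) *v u)" for t
  have g'': "g'' t = (\<Sum>i\<in>UNIV. u $ i *
      (\<Sum>j\<in>UNIV. u $ j * partial_deriv j (partial_deriv i f) (x + t *\<^sub>R u)))" for t
    unfolding g''_def hessian_def
    by (simp add: inner_vec_def matrix_vector_mult_def sum_distrib_left, subst sum.swap)
      (simp add: mult_ac)
  have "(g' has_real_derivative g'' t) (at t)" for t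
    unfolding g'' g'_def
    by (intro DERIV_sum DERIV_cmult real_polynomial_function_has_directional_derivative
        real_polynomial_function_partial_deriv f)
  moreover have "(g has_real_derivative g' t) (at t)" for t
    unfolding g_def g'_def by (intro real_polynomial_function_has_directional_derivative f)
  moreover have "0 \<le> g'' t" for t
    using hess unfolding g''_def pos_semidef_def by blast
  ultimately have "g' 0 * (1 - 0) \<le> g 1 - g 0"
    by (intro f''_imp_f'[of UNIV g g' g'']) auto
  then show ?thesis
    by (simp add: g_def g'_def)
qed

text \<open>Euler's identity evaluates the differential on the base point x, leaving a left side
  that is linear in y.\<close>

lemma convex_form_tangent_inequality:
  assumes "p \<in> convex_forms d"
  shows "(\<Sum>i\<in>UNIV. y $ i * partial_deriv i p x) \<le> p y + (2 * real d - 1) * p x"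
proof -
  have p: "p \<in> forms (2 * d)" and hess: "\<And>z. pos_semidef (hessian p z)"
    using assms unfolding convex_forms_def by auto
  have "(\<Sum>i\<in>UNIV. (y - x) $ i * partial_deriv i p x) \<le> p (x + (y - x)) - p x"
    using form_imp_real_polynomial_function[OF p] hess by (rule tangent_inequality)
  moreover have "(\<Sum>i\<in>UNIV. (y - x) $ i * partial_deriv i p x)
      = (\<Sum>i\<in>UNIV. y $ i * partial_deriv i p x) - 2 * real d * p x"
    using Euler_identity[OF p, of x] by (simp add: left_diff_distrib sum_subtractf)
  ultimately show ?thesis
    by (simp add: algebra_simps)
qed

lemma convex_form_nonneg:
  assumes "p \<in> convex_forms d" "0 < d"
  shows "0 \<le> p x"
proof -
  have "p 0 = 0"
    using form_scaleR[of p "2 * d" 0 0] assms by (simp add: convex_forms_def power_0_left)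
  \<comment> \<open>The tangent at x, evaluated at the origin, where p vanishes.\<close>
  then have "0 \<le> (2 * real d - 1) * p x"
    using convex_form_tangent_inequality[OF assms(1), of 0 x] by simp
  then show ?thesis
    using assms(2) by (simp add: zero_le_mult_iff)
qed

lemma convex_form_norming_functional:
  fixes p :: "real ^ 'n::finite \<Rightarrow> real"
  assumes "p \<in> convex_forms d" "0 < d" "0 < p x"
  obtains l :: "real ^ 'n" where "l \<bullet> x = 1" "\<And>y. (l \<bullet> y) ^ (2 * d) * p x \<le> p y"
proof
  define l :: "real ^ 'n" where "l = (\<chi> i. partial_deriv i p x / (2 * real d * p x))"
  have p: "p \<in> forms (2 * d)"
    using assms(1) by (simp add: convex_forms_def)
  have l: "(\<Sum>i\<in>UNIV. y $ i * partial_deriv i p x) = 2 * real d * p x * (l \<bullet> y)" for y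
    using assms(2,3) by (simp add: l_def inner_vec_def sum_distrib_left mult_ac)
  show "l \<bullet> x = 1"
    using l[of x] Euler_identity[OF p, of x] assms(2,3) by simp
  show "(l \<bullet> y) ^ (2 * d) * p x \<le> p y" for y
  proof (cases "l \<bullet> y = 0")
    case True
    \<comment> \<open>Here y cannot be rescaled, but the left side is 0 because the exponent is
      positive.\<close>
    then show ?thesis
      using convex_form_nonneg[OF assms(1,2)] assms(2) by (simp add: power_0_left)
  next
    case False
    \<comment> \<open>The rescaled point satisfies \<open>l \<bullet> z = 1\<close>, so the tangent
      inequality becomes 2d p(x) \<le> p(z) + (2d - 1) p(x).\<close>
    have "p x \<le> p ((1 / (l \<bullet> y)) *\<^sub>R y)"
      using convex_form_tangent_inequality[OF assms(1), of "(1 / (l \<bullet> y)) *\<^sub>R y" x] False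
      unfolding l by (simp add: algebra_simps)
    also have "\<dots> = p y / (l \<bullet> y) ^ (2 * d)"
      by (simp add: form_scaleR[OF p] power_one_over)
    \<comment> \<open>The exponent is even, so the denominator is positive even if
      \<open>l \<bullet> y\<close> is negative.\<close>
    finally show ?thesis
      using False by (simp add: pos_le_divide_eq mult.commute zero_less_power_eq)
  qed
qed

section \<open>From the cube identity to the inequality of the conjecture\<close>

lemma outer_cube_sum_imp_inner_cube_sum:
  fixes l :: "real ^ 'n::finite"
  assumes "outer_cube w = (\<Sum>s\<in>S. \<alpha> s *\<^sub>R outer_cube (v s))"
  shows "(l \<bullet> w) ^ 3 = (\<Sum>s\<in>S. \<alpha> s * (l \<bullet> v s) ^ 3)"
proof -
  \<comment> \<open>Contraction of a 3-tensor with \<open>l\<close> in every slot.\<close>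
  define T where "T M = l \<bullet> (\<chi> i. l \<bullet> (\<chi> j. l \<bullet> (M $ i $ j)))" for M :: "real ^ 'n ^ 'n ^ 'n"
  have "linear T"
    unfolding T_def
    by (rule linearI) (simp_all add: inner_vec_def algebra_simps sum.distrib sum_distrib_left)
  moreover have "T (outer_cube u) = (l \<bullet> u) ^ 3" for u
    unfolding T_def outer_cube_def
    by (simp add: inner_vec_def power3_eq_cube sum_distrib_left sum_distrib_right mult_ac)
  ultimately show ?thesis
    using arg_cong[OF assms, of T] by (simp add: linear_sum linear_scale)
qed

lemma convex_sextic_generalized_Cauchy_Schwarz:
  assumes p: "p \<in> convex_forms 3"
    and \<alpha>: "\<And>s. s \<in> S \<Longrightarrow> \<bar>\<alpha> s\<bar> \<le> 1"
    and cube: "outer_cube w = (\<Sum>s\<in>S. \<alpha> s *\<^sub>R outer_cube (v s))"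
  shows "p w \<le> (\<Sum>s\<in>S. sqrt (p (v s)))\<^sup>2"
proof (cases "0 < p w")
  case True
  obtain l where l: "l \<bullet> w = 1" "\<And>y. (l \<bullet> y) ^ (2 * 3) * p w \<le> p y"
    using convex_form_norming_functional[OF p _ True] by auto
  \<comment> \<open>The square root of the norming inequality, whose exponent is 6; the absolute
    value keeps the cube nonnegative.\<close>
  have bound: "\<bar>l \<bullet> y\<bar> ^ 3 * sqrt (p w) \<le> sqrt (p y)" for y
  proof (rule real_le_rsqrt)
    show "(\<bar>l \<bullet> y\<bar> ^ 3 * sqrt (p w))\<^sup>2 \<le> p y"
      using l(2)[of y] True by (simp add: power_mult_distrib flip: power_mult)
  qed
  have "1 = (\<Sum>s\<in>S. \<alpha> s * (l \<bullet> v s) ^ 3)"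
    using outer_cube_sum_imp_inner_cube_sum[OF cube, of l] l(1) by simp
  also have "\<dots> \<le> (\<Sum>s\<in>S. \<bar>l \<bullet> v s\<bar> ^ 3)"
  proof (rule sum_mono)
    fix s assume "s \<in> S"
    have "\<alpha> s * (l \<bullet> v s) ^ 3 \<le> \<bar>\<alpha> s\<bar> * \<bar>l \<bullet> v s\<bar> ^ 3"
      using abs_ge_self[of "\<alpha> s * (l \<bullet> v s) ^ 3"] by (simp add: abs_mult power_abs)
    also have "\<dots> \<le> 1 * \<bar>l \<bullet> v s\<bar> ^ 3"
      using \<alpha>[OF \<open>s \<in> S\<close>] by (intro mult_right_mono) auto
    finally show "\<alpha> s * (l \<bullet> v s) ^ 3 \<le> \<bar>l \<bullet> v s\<bar> ^ 3" by simp
  qed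
  finally have "1 * sqrt (p w) \<le> (\<Sum>s\<in>S. \<bar>l \<bullet> v s\<bar> ^ 3) * sqrt (p w)"
    using True by (intro mult_right_mono) auto
  also have "\<dots> \<le> (\<Sum>s\<in>S. sqrt (p (v s)))"
    unfolding sum_distrib_right by (intro sum_mono bound)
  finally show ?thesis
    by (simp add: sqrt_le_D)
next
  case False
  \<comment> \<open>Now p(w) \<le> 0, while the right side is a square.\<close>
  then show ?thesis
    by (smt (verit) zero_le_power2)
qed

theorem mainTheorem2:
  assumes blekherman_conjecture:
    "\<forall>p \<in> (psd_forms 3 :: (real ^ 3 \<Rightarrow> real) set).
       p \<in> sos_forms 3 \<longleftrightarrow>
       (\<forall>(v :: nat \<Rightarrow> real ^ 3) (\<alpha> :: nat \<Rightarrow> real).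
          (\<forall>i\<in>{2..9}. \<alpha> i \<in> {-1, 1}) \<and>
          outer_cube (v 1) = (\<Sum>i=2..9. \<alpha> i *\<^sub>R outer_cube (v i)) \<longrightarrow>
          p (v 1) \<le> (\<Sum>i=2..9. sqrt (p (v i)))\<^sup>2)"
  shows "(convex_forms 3 :: (real ^ 3 \<Rightarrow> real) set) \<subseteq> sos_forms 3"
proof
  fix p :: "real ^ 3 \<Rightarrow> real"
  assume p: "p \<in> convex_forms 3"
  \<comment> \<open>The criterion is assumed for nonnegative forms, so this comes first.\<close>
  have "p \<in> psd_forms 3"
    using p convex_form_nonneg[OF p] by (simp add: psd_forms_def convex_forms_def)
  moreover have "p (v 1) \<le> (\<Sum>i=2..9. sqrt (p (v i)))\<^sup>2"
    if "\<forall>i\<in>{2..9}. \<alpha> i \<in> {-1, 1}"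
      and "outer_cube (v 1) = (\<Sum>i=2..9. \<alpha> i *\<^sub>R outer_cube (v i))"
    for v :: "nat \<Rightarrow> real ^ 3" and \<alpha> :: "nat \<Rightarrow> real"
    using convex_sextic_generalized_Cauchy_Schwarz[OF p _ that(2)] that(1) by force
  ultimately show "p \<in> sos_forms 3"
    using blekherman_conjecture by blast
qed

end
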